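(* Let $k\geq 2$ be an integer and let $A$ be a finite set of $k$ non-negative integers with $0\in A$ such that $|2\hat{}_{\underline{+}}A|=4k-6$. Then: (i) if $k=2$, $A=\{0,a\}$ for some integer $a>0$; (ii) if $k\geq 3$, $A=d*[0,k-1]$ for some positive integer $d$.
   Context: For a finite set $A=\{a_0,a_1,\ldots,a_{k-1}\}$ of $k$ distinct integers and an integer $1\leq h\leq k$, the $h$-fold restricted signed sumset of $A$ is $$h\hat{}_{\underline{+}}A:=\Big\{\sum_{i=0}^{k-1}\lambda_i a_i : (\lambda_0,\ldots,\lambda_{k-1})\in\{-1,0,1\}^k,\ \sum_{i=0}^{k-1}|\lambda_i|=h\Big\}.$$ $|S|$ denotes the cardinality of a finite set $S$. For integers $a\leq b$, $[a,b]=\{n\in\mathbb{Z}: a\leq n\leq b\}$. For an integer $d$ and a set $S$ of integers, $d*S=\{d\cdot s : s\in S\}$ is the $d$-dilation of $S$. *)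

theory Defs
  imports "HOL-Library.FuncSet"
begin

text \<open>
  The coefficients are indexed by the elements of \<open>A\<close> themselves instead of by positions
  in an enumeration \<open>a\<^sub>0, \<dots>, a\<^sub>k\<^sub>-\<^sub>1\<close> of \<open>A\<close>. The definition is meant for finite \<open>A\<close> and
  \<open>1 \<le> h \<le> card A\<close>.
\<close>

definition restricted_signed_sumset :: "nat \<Rightarrow> int set \<Rightarrow> int set" where
  "restricted_signed_sumset h A =
     {(\<Sum>a\<in>A. l a * a) | l :: int \<Rightarrow> int.
        l \<in> A \<rightarrow> {-1, 0, 1} \<and> (\<Sum>a\<in>A. \<bar>l a\<bar>) = int h}"

definition dilation :: "int \<Rightarrow> int set \<Rightarrow> int set" where
  "dilation d S = {d * s | s. s \<in> S}"

end

theory Submission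
  imports Defs
begin

text \<open>
  Write \<open>M\<close> for the largest element of \<open>A\<close> and \<open>S\<close> for the sumset. The \<open>k - 1\<close> positive
  elements \<open>a\<close> of \<open>A\<close> arise as \<open>a + 0\<close>, and the \<open>k - 2\<close> numbers \<open>M + a\<close> with
  \<open>0 < a < M\<close> all exceed \<open>M\<close>. Together with their negatives these are already \<open>4k - 6\<close>
  elements of \<open>S\<close>, so equality in cardinality leaves room for nothing else
  (\<open>extremal_signed_sumset\<close>). But \<open>S\<close> also contains every difference of two distinct elements
  of \<open>A\<close>; a positive one is at most \<open>M\<close>, and the only listed elements in \<open>[1, M]\<close> are those
  of \<open>A\<close>. Hence \<open>A\<close> is closed under non-negative differences.

  A finite set of non-negative integers with this closure property is an arithmetic progression
  starting at \<open>0\<close>: its least positive element \<open>d\<close> divides every element by the division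
  algorithm, and descending from \<open>M\<close> in steps of \<open>d\<close> meets every multiple of \<open>d\<close> up to \<open>M\<close>
  (\<open>difference_closed_is_dilation\<close>). Both parts of the theorem follow from this description.
\<close>

lemma signed_pair_in_sumset:
  assumes "finite A" "x \<in> A" "y \<in> A" "x \<noteq> y" "s \<in> {-1, 1}" "t \<in> {-1, 1}"
  shows "s * x + t * y \<in> restricted_signed_sumset 2 A"
proof -
  define l where "l = (\<lambda>a. if a = x then s else if a = y then t else (0::int))"
  have vanish: "sum f A = f x + f y" if "\<And>a. a \<in> A - {x, y} \<Longrightarrow> f a = 0" for f :: "int \<Rightarrow> int"
  proof -
    have "sum f A = sum f {x, y}"
      using assms that by (intro sum.mono_neutral_right) auto
    then show ?thesis using assms by simp
  qed
  have "(\<Sum>a\<in>A. l a * a) = s * x + t * y"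
    using assms by (subst vanish) (auto simp: l_def)
  moreover have "(\<Sum>a\<in>A. \<bar>l a\<bar>) = int 2"
    using assms by (subst vanish) (auto simp: l_def)
  moreover have "l \<in> A \<rightarrow> {-1, 0, 1}"
    using assms(5,6) unfolding l_def by (intro Pi_I) (simp split: if_split; blast)
  ultimately show ?thesis
    unfolding restricted_signed_sumset_def by (auto intro!: exI[of _ l])
qed

text \<open>
  The two parts of \<open>B\<close> are separated by the value \<open>Max A\<close>, and \<open>B\<close> and its negative by \<open>0\<close>.
  No elements coincide, so \<open>B \<union> uminus ` B\<close> has \<open>2 * ((k - 1) + (k - 2)) = 4k - 6\<close> elements where
  \<open>k = card A\<close>. It is contained in a finite set of the same size.
\<close>

lemma extremal_signed_sumset:
  fixes A :: "int set"
  defines "B \<equiv> (A - {0}) \<union> (+) (Max A) ` (A - {0, Max A})"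
  assumes "finite A" "card A \<ge> 2" "\<forall>a\<in>A. a \<ge> 0" "0 \<in> A"
    and "int (card (restricted_signed_sumset 2 A)) = 4 * int (card A) - 6"
  shows "restricted_signed_sumset 2 A = B \<union> uminus ` B"
proof -
  define M where "M = Max A"
  let ?S = "restricted_signed_sumset 2 A"
  note pair = signed_pair_in_sumset[OF \<open>finite A\<close>]
  have M: "M \<in> A" "\<And>a. a \<in> A \<Longrightarrow> a \<le> M"
    unfolding M_def using assms(2,5) by (blast intro: Max_in Max_ge)+
  have "M \<noteq> 0"
  proof
    assume "M = 0"
    then have "A \<subseteq> {0}" using M(2) assms(4) by force
    then have "card A \<le> 1" using card_mono[of "{0}" A] by simp
    then show False using assms(3) by simp
  qed
  have B: "B = (A - {0}) \<union> (+) M ` (A - {0, M})"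
    by (simp add: B_def M_def)
  have "finite B" using assms(2) by (simp add: B)
  have "a > 0" if "a \<in> A" "a \<noteq> 0" for a using that assms(4) by force
  then have B_pos: "b > 0" if "b \<in> B" for b
    using that M(1) \<open>M \<noteq> 0\<close> by (auto simp: B intro!: add_pos_pos)
  have "card (A - {0}) = card A - 1" "card (A - {0, M}) = card A - 2"
    using assms(2,5) M(1) \<open>M \<noteq> 0\<close> by (simp_all add: card_Diff_subset)
  moreover have "(A - {0}) \<inter> (+) M ` (A - {0, M}) = {}"
    using M(2) assms(4) by force
  ultimately have "card B = (card A - 1) + (card A - 2)"
    using assms(2) by (simp add: B card_Un_disjoint card_image)
  moreover have "card (B \<union> uminus ` B) = card B + card B"
  proof -
    have "B \<inter> uminus ` B = {}" by (auto dest!: B_pos)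
    then show ?thesis using \<open>finite B\<close> by (simp add: card_Un_disjoint card_image)
  qed
  ultimately have "card (B \<union> uminus ` B) = card ?S"
    using assms(3,6) by linarith
  moreover have "B \<union> uminus ` B \<subseteq> ?S"
  proof -
    have "b \<in> ?S \<and> - b \<in> ?S" if "b \<in> B" for b
    proof -
      obtain x y where "x \<in> A" "y \<in> A" "x \<noteq> y" "b = x + y"
      proof (cases "b \<in> A - {0}")
        case True
        then show ?thesis using that[of b 0] assms(5) by simp
      next
        case False
        then show ?thesis using \<open>b \<in> B\<close> that[of M] M(1) by (auto simp: B)
      qed
      then show ?thesis using pair[of x y 1 1] pair[of x y "-1" "-1"] by simp
    qed
    then show ?thesis by blast
  qed
  moreover have "finite ?S"
    using assms(3,6) by (intro card_ge_0_finite) linarith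
  ultimately show ?thesis using card_subset_eq by metis
qed

text \<open>
  Repeated subtraction of \<open>d\<close>, the least positive element, serves twice: started at an arbitrary
  element it ends in the remainder modulo \<open>d\<close>, which must vanish; started at the maximum it shows
  that no multiple of \<open>d\<close> is skipped.
\<close>

lemma difference_closed_is_dilation:
  fixes A :: "int set"
  assumes "finite A" "card A \<ge> 2" "\<forall>a\<in>A. a \<ge> 0" "0 \<in> A"
    and closed: "\<And>x y. x \<in> A \<Longrightarrow> y \<in> A \<Longrightarrow> x \<le> y \<Longrightarrow> y - x \<in> A"
  shows "\<exists>d>0. A = dilation d {0..int (card A) - 1}"
proof -
  define d where "d = Min (A - {0})"
  define M where "M = Max A"
  have "card (A - {0}) \<ge> 1" using assms(1,2,4) by simp
  then have "A - {0} \<noteq> {}" by force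
  then have "d \<in> A - {0}" and d_le: "\<And>a. a \<in> A \<Longrightarrow> a \<noteq> 0 \<Longrightarrow> d \<le> a"
    using assms(1) Min_in[of "A - {0}"] by (auto simp: d_def)
  then have d: "d \<in> A" "d > 0" using assms(3) by force+
  have M: "M \<in> A" "\<And>a. a \<in> A \<Longrightarrow> a \<le> M"
    unfolding M_def using assms(1,4) by (blast intro: Max_in Max_ge)+
  have descend: "x - d * int j \<in> A" if "x \<in> A" "d * int j \<le> x" for x j
    using that(2)
  proof (induction j)
    case 0
    then show ?case using that(1) by simp
  next
    case (Suc j)
    then have "d \<le> x - d * int j" "d * int j \<le> x"
      using d(2) by (simp_all add: algebra_simps)
    then have "x - d * int j - d \<in> A" using closed[OF d(1)] Suc.IH by simp
    then show ?case by (simp add: algebra_simps)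
  qed
  have dvd: "d dvd x" if "x \<in> A" for x
  proof -
    have "0 \<le> x div d" using that assms(3) d(2) by (simp add: pos_imp_zdiv_nonneg_iff)
    moreover have rem: "x - d * (x div d) = x mod d" by (simp add: minus_mult_div_eq_mod)
    moreover have "x mod d \<ge> 0" "x mod d < d" using d(2) by simp_all
    ultimately have "x mod d \<in> A" using descend[OF that, of "nat (x div d)"] by simp
    \<comment> \<open>A remainder lying in \<open>A\<close> but below its least positive element is zero.\<close>
    then have "x mod d = 0" using d_le \<open>x mod d < d\<close> by force
    then show ?thesis by (simp add: dvd_eq_mod_eq_0)
  qed
  define n where "n = M div d"
  have Mn: "M = d * n" using dvd[OF M(1)] by (simp add: n_def)
  have "n \<ge> 0" using M(1) assms(3) d(2) by (simp add: n_def pos_imp_zdiv_nonneg_iff)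
  have A: "A = (*) d ` {0..n}"
  proof (intro equalityI subsetI)
    fix x assume "x \<in> A"
    then obtain q where q: "x = d * q" using dvd by blast
    have "0 \<le> d * q" "d * q \<le> d * n"
      using \<open>x \<in> A\<close> assms(3) M(2) Mn q by auto
    then have "0 \<le> q" "q \<le> n" using d(2) by (simp_all add: zero_le_mult_iff)
    then show "x \<in> (*) d ` {0..n}" using q by auto
  next
    fix x assume "x \<in> (*) d ` {0..n}"
    then obtain q where q: "x = d * q" "q \<in> {0..n}" by (rule imageE)
    then have "x = M - d * int (nat (n - q))" "d * int (nat (n - q)) \<le> M"
      using d(2) by (simp_all add: Mn right_diff_distrib)
    then show "x \<in> A" using descend[OF M(1), of "nat (n - q)"] by simp
  qed
  have "inj_on ((*) d) {0..n}" using d(2) by (simp add: inj_on_def)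
  then have "int (card A) - 1 = n" using \<open>n \<ge> 0\<close> by (simp add: A card_image)
  then have "A = dilation d {0..int (card A) - 1}"
    using A by (auto simp: dilation_def)
  then show ?thesis using d(2) by blast
qed

theorem theorem3p2:
  fixes k :: nat and A :: "int set"
  assumes "k \<ge> 2"
    and "finite A"
    and "card A = k"
    and "\<forall>a\<in>A. a \<ge> 0"
    and "0 \<in> A"
    and "int (card (restricted_signed_sumset 2 A)) = 4 * int k - 6"
  shows "(k = 2 \<longrightarrow> (\<exists>a. a > 0 \<and> A = {0, a})) \<and>
         (k \<ge> 3 \<longrightarrow> (\<exists>d. d > 0 \<and> A = dilation d {0..int k - 1}))"
proof -
  define B where "B = (A - {0}) \<union> (+) (Max A) ` (A - {0, Max A})"
  have "card A \<ge> 2" using assms(1,3) by simp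
  have S: "restricted_signed_sumset 2 A = B \<union> uminus ` B"
    unfolding B_def using assms by (intro extremal_signed_sumset) auto
  have Max: "a \<le> Max A" if "a \<in> A" for a using that assms(2) by simp
  have "Max A \<ge> 0" using Max assms(5) .
  have "y - x \<in> A" if xy: "x \<in> A" "y \<in> A" "x \<le> y" for x y
  proof (cases "x = y")
    case True
    then show ?thesis using assms(5) by simp
  next
    case False
    then have "y - x \<in> B \<union> uminus ` B"
      using signed_pair_in_sumset[OF assms(2), of y x 1 "-1"] xy by (simp add: S)
    moreover have "b \<ge> 0" if "b \<in> B" for b
      using that assms(4) \<open>Max A \<ge> 0\<close> by (auto simp: B_def)
    ultimately have "y - x \<in> B" using False xy(3) by force
    moreover have "y - x \<le> Max A" using Max[OF xy(2)] xy(1) assms(4) by force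
    ultimately show ?thesis using assms(4) by (force simp: B_def)
  qed
  then obtain d where d: "d > 0" "A = dilation d {0..int k - 1}"
    using difference_closed_is_dilation[OF assms(2) \<open>card A \<ge> 2\<close> assms(4,5)] assms(3) by auto
  have "A = {0, d}" if "k = 2"
  proof -
    have "{0..int k - 1} = {0, 1}" using that by auto
    then show ?thesis using d(2) by (auto simp: dilation_def)
  qed
  then show ?thesis using d by blast
qed

end
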